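(* Let $P$ be a FASP program. An interpretation $A$ of $P$ is an answer set of $P$ if and only if $A = \Pi_{P^A}^{*}$, where $\Pi_{P^A}^{*}$ is the least fixpoint of the immediate consequence operator of the reduct $P^A$ of $P$ w.r.t. $A$.
   Context: "Increasing" and "decreasing" are meant in the non-strict sense. A t-norm is an increasing, commutative, associative map $\mathcal{T}:[0,1]^2\to[0,1]$ with $\mathcal{T}(1,x)=x$ for all $x$; all t-norms are assumed left-continuous. The residual implicator of $\mathcal{T}$ is $\mathcal{I}(x,y)=\sup\{\lambda\in[0,1]\mid \mathcal{T}(x,\lambda)\le y\}$. A negator is a decreasing map $\mathcal{N}:[0,1]\to[0,1]$ with $\mathcal{N}(0)=1$, $\mathcal{N}(1)=0$. FASP programs. A literal is either an atom or a constant from $[0,1]$. An extended literal is either a literal (positive extended literal) or an expression $\mathcal{N}(a)$ with $a$ an atom and $\mathcal{N}$ an arbitrary negator (negative extended literal). A rule $r$ has the form $a\leftarrow \mathcal{T}(b_1,\ldots,b_n)$ with $n>0$, $a$ a literal (the head $H(r)$), $b_1,\ldots,b_n$ extended literals (forming the body $B(r)$) and $\mathcal{T}$ an arbitrary t-norm, where $\mathcal{T}(b)=b$ and $\mathcal{T}(b_1,\ldots,b_n)=\mathcal{T}(b_1,\mathcal{T}(b_2,\ldots))$. The t-norm and the negators may differ from rule to rule. $Lit^+(B(r))$ is the set of positive extended literals in the body of $r$, and $\mathcal{I}_r$ is the residual implicator of the t-norm in the body of $r$. (Rules with a constant as head, called constraints, are allowed.) A FASP program $P$ is a finite set of rules;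 $\mathcal{B}_P$ is the finite set of all atoms occurring in $P$; for an atom $a$, $P_a$ is the set of rules of $P$ with head $a$. Interpretations. An interpretation $I$ of $P$ is a map $I:\mathcal{B}_P\to[0,1]$, extended by $I(c)=c$ for $c\in[0,1]$, $I(\mathcal{N}(a))=\mathcal{N}(I(a))$, $I(B(r))=\mathcal{T}(I(b_1),\ldots,I(b_n))$ and $I(r)=\mathcal{I}_r(I(B(r)),I(H(r)))$ for a rule $r: a\leftarrow\mathcal{T}(b_1,\ldots,b_n)$. $I$ is a model of $P$ iff $I(r)=1$ for every $r\in P$. The support is $supp(I)=\{a\in\mathcal{B}_P\mid I(a)>0\}$. Interpretations are ordered pointwise. Answer sets. A set $U\subseteq\mathcal{B}_P$ is unfounded w.r.t. $I$ iff for each $u\in U$ and each $r\in P_u$ at least one of the following holds: (1) $U\cap Lit^+(B(r))\ne\emptyset$; (2) $I(u)>I(B(r))$; (3) $I(B(r))=0$. $I$ is unfounded-free iff $supp(I)\cap U=\emptyset$ for every set $U$ unfounded w.r.t. $I$. An answer set of $P$ is a model of $P$ that is unfounded-free. Immediate consequence operator and reduct. $\Pi_P$ maps an interpretation $I$ to the interpretation $\Pi_P(I)(l)=\sup\{I(B(r))\mid r\in P_l\}$ for $l\in\mathcal{B}_P$ (with $\sup\emptyset=0$). The reduct $r^I$ of a rule $r$ w.r.t. an interpretation $I$ is obtained by replacing every negative extended literal $\mathcal{N}(b)$ in its body by the constant $I(\mathcal{N}(b))$; $P^I=\{r^I\mid r\in P\}$. $\Pi_{P^I}$ is regarded as an operator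 on maps $\mathcal{B}_P\to[0,1]$; since $P^I$ has no negative extended literals, it is monotone and has a least fixpoint, denoted $\Pi_{P^I}^{*}$.
   Formalization: As stated, the "if" direction fails for programs with constraints (e.g. the rule 0 ← 1/2), since the immediate consequence operator ignores them; the right-hand side therefore also requires A(r) = 1 for every rule r of P with a constant head. *)

theory Defs
  imports Complex_Main "HOL-Library.FuncSet"
begin

text \<open>Truth values are the reals in \<open>{0..1}\<close>. Connectives are functions on the reals that are
  only constrained, and only ever applied, on \<open>{0..1}\<close>.\<close>

definition tnorm :: "(real \<Rightarrow> real \<Rightarrow> real) \<Rightarrow> bool" where
  "tnorm T \<longleftrightarrow>
     (\<forall>x\<in>{0..1}. \<forall>y\<in>{0..1}. T x y \<in> {0..1}) \<and>
     (\<forall>x\<in>{0..1}. \<forall>x'\<in>{0..1}. \<forall>y\<in>{0..1}. \<forall>y'\<in>{0..1}.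
        x \<le> x' \<longrightarrow> y \<le> y' \<longrightarrow> T x y \<le> T x' y') \<and>
     (\<forall>x\<in>{0..1}. \<forall>y\<in>{0..1}. T x y = T y x) \<and>
     (\<forall>x\<in>{0..1}. \<forall>y\<in>{0..1}. \<forall>z\<in>{0..1}. T (T x y) z = T x (T y z)) \<and>
     (\<forall>x\<in>{0..1}. T 1 x = x)"

text \<open>By commutativity, left-continuity in the second argument is left-continuity in each argument.\<close>

definition left_continuous_tnorm :: "(real \<Rightarrow> real \<Rightarrow> real) \<Rightarrow> bool" where
  "left_continuous_tnorm T \<longleftrightarrow>
     tnorm T \<and> (\<forall>x\<in>{0..1}. \<forall>y\<in>{0<..1}. continuous (at_left y) (T x))"

definition residual_implicator :: "(real \<Rightarrow> real \<Rightarrow> real) \<Rightarrow> real \<Rightarrow> real \<Rightarrow> real" where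
  "residual_implicator T x y = Sup {l \<in> {0..1}. T x l \<le> y}"

definition negator :: "(real \<Rightarrow> real) \<Rightarrow> bool" where
  "negator N \<longleftrightarrow>
     (\<forall>x\<in>{0..1}. N x \<in> {0..1}) \<and>
     (\<forall>x\<in>{0..1}. \<forall>y\<in>{0..1}. x \<le> y \<longrightarrow> N y \<le> N x) \<and>
     N 0 = 1 \<and> N 1 = 0"

datatype 'a literal = Atom 'a | Const real

datatype 'a ext_literal = Pos "'a literal" | Neg "real \<Rightarrow> real" 'a

datatype (atoms_rule: 'a) rule =
  Rule (head: "'a literal") (rule_tnorm: "real \<Rightarrow> real \<Rightarrow> real") (body: "'a ext_literal list")

fun wf_literal :: "'a literal \<Rightarrow> bool" where
  "wf_literal (Atom a) \<longleftrightarrow> True"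
| "wf_literal (Const c) \<longleftrightarrow> c \<in> {0..1}"

fun wf_ext_literal :: "'a ext_literal \<Rightarrow> bool" where
  "wf_ext_literal (Pos l) \<longleftrightarrow> wf_literal l"
| "wf_ext_literal (Neg N a) \<longleftrightarrow> negator N"

definition wf_rule :: "'a rule \<Rightarrow> bool" where
  "wf_rule r \<longleftrightarrow> wf_literal (head r) \<and> left_continuous_tnorm (rule_tnorm r) \<and>
     body r \<noteq> [] \<and> (\<forall>b\<in>set (body r). wf_ext_literal b)"

definition fasp_program :: "'a rule set \<Rightarrow> bool" where
  "fasp_program P \<longleftrightarrow> finite P \<and> (\<forall>r\<in>P. wf_rule r)"

definition atoms :: "'a rule set \<Rightarrow> 'a set" where
  "atoms P = (\<Union>r\<in>P. atoms_rule r)"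

definition rules_for :: "'a rule set \<Rightarrow> 'a \<Rightarrow> 'a rule set" where
  "rules_for P a = {r \<in> P. head r = Atom a}"

text \<open>Constraints take part in the definition of a model, but not in the immediate consequence
  operator, which only sees rules with an atom as head.\<close>

definition constraints :: "'a rule set \<Rightarrow> 'a rule set" where
  "constraints P = {r \<in> P. \<exists>c. head r = Const c}"

definition pos_lits :: "'a rule \<Rightarrow> 'a literal set" where
  "pos_lits r = {l. Pos l \<in> set (body r)}"

text \<open>Maps from \<open>B\<close> to \<open>[0,1]\<close> are extensional functions, so that the order and equality
  of the function type are the pointwise order and equality on \<open>B\<close>.\<close>

definition interps :: "'a set \<Rightarrow> ('a \<Rightarrow> real) set" where
  "interps B = B \<rightarrow>\<^sub>E {0..1}"

fun lit_val :: "('a \<Rightarrow> real) \<Rightarrow> 'a literal \<Rightarrow> real" where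
  "lit_val I (Atom a) = I a"
| "lit_val I (Const c) = c"

fun ext_val :: "('a \<Rightarrow> real) \<Rightarrow> 'a ext_literal \<Rightarrow> real" where
  "ext_val I (Pos l) = lit_val I l"
| "ext_val I (Neg N a) = N (I a)"

text \<open>The value for the empty list is irrelevant, since rule bodies are nonempty.\<close>

fun tnorm_list :: "(real \<Rightarrow> real \<Rightarrow> real) \<Rightarrow> real list \<Rightarrow> real" where
  "tnorm_list T [] = 1"
| "tnorm_list T [x] = x"
| "tnorm_list T (x # y # zs) = T x (tnorm_list T (y # zs))"

definition body_val :: "('a \<Rightarrow> real) \<Rightarrow> 'a rule \<Rightarrow> real" where
  "body_val I r = tnorm_list (rule_tnorm r) (map (ext_val I) (body r))"

definition rule_val :: "('a \<Rightarrow> real) \<Rightarrow> 'a rule \<Rightarrow> real" where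
  "rule_val I r = residual_implicator (rule_tnorm r) (body_val I r) (lit_val I (head r))"

definition model :: "'a rule set \<Rightarrow> ('a \<Rightarrow> real) \<Rightarrow> bool" where
  "model P I \<longleftrightarrow> (\<forall>r\<in>P. rule_val I r = 1)"

definition supp :: "'a rule set \<Rightarrow> ('a \<Rightarrow> real) \<Rightarrow> 'a set" where
  "supp P I = {a \<in> atoms P. I a > 0}"

definition unfounded :: "'a rule set \<Rightarrow> ('a \<Rightarrow> real) \<Rightarrow> 'a set \<Rightarrow> bool" where
  "unfounded P I U \<longleftrightarrow> U \<subseteq> atoms P \<and>
     (\<forall>u\<in>U. \<forall>r\<in>rules_for P u.
        Atom ` U \<inter> pos_lits r \<noteq> {} \<or> I u > body_val I r \<or> body_val I r = 0)"

definition unfounded_free :: "'a rule set \<Rightarrow> ('a \<Rightarrow> real) \<Rightarrow> bool" where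
  "unfounded_free P I \<longleftrightarrow> (\<forall>U. unfounded P I U \<longrightarrow> supp P I \<inter> U = {})"

definition answer_set :: "'a rule set \<Rightarrow> ('a \<Rightarrow> real) \<Rightarrow> bool" where
  "answer_set P I \<longleftrightarrow> I \<in> interps (atoms P) \<and> model P I \<and> unfounded_free P I"

text \<open>The domain \<open>B\<close> of the operator is explicit because the reduct of \<open>P\<close> may have fewer atoms
  than \<open>P\<close>, while its operator acts on the interpretations of \<open>P\<close>.\<close>

definition imm_cons :: "'a set \<Rightarrow> 'a rule set \<Rightarrow> ('a \<Rightarrow> real) \<Rightarrow> ('a \<Rightarrow> real)" where
  "imm_cons B P I = (\<lambda>a\<in>B. if rules_for P a = {} then 0 else (SUP r\<in>rules_for P a. body_val I r))"

fun reduct_ext :: "('a \<Rightarrow> real) \<Rightarrow> 'a ext_literal \<Rightarrow> 'a ext_literal" where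
  "reduct_ext I (Pos l) = Pos l"
| "reduct_ext I (Neg N a) = Pos (Const (N (I a)))"

definition reduct_rule :: "('a \<Rightarrow> real) \<Rightarrow> 'a rule \<Rightarrow> 'a rule" where
  "reduct_rule I r = Rule (head r) (rule_tnorm r) (map (reduct_ext I) (body r))"

definition reduct :: "'a rule set \<Rightarrow> ('a \<Rightarrow> real) \<Rightarrow> 'a rule set" where
  "reduct P I = reduct_rule I ` P"

definition least_fixpoint :: "'a set \<Rightarrow> (('a \<Rightarrow> real) \<Rightarrow> ('a \<Rightarrow> real)) \<Rightarrow> ('a \<Rightarrow> real)" where
  "least_fixpoint B F = (LEAST J. J \<in> interps B \<and> F J = J)"

end

theory Submission
  imports Defs
begin

text \<open>If \<open>A\<close> is an answer set and \<open>J\<close> a fixpoint of the operator of the reduct, then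
  \<open>{a. J a < A a}\<close> is unfounded, hence empty. Conversely, let \<open>A\<close> be the least fixpoint and
  suppose that the unfounded set \<open>U\<close> meets the support of \<open>A\<close>. Take the points of \<open>U\<close> where \<open>A\<close>
  attains its maximum \<open>m > 0\<close> on \<open>U\<close> and lower \<open>A\<close> there to the largest value below \<open>m\<close> among \<open>0\<close>,
  the values of \<open>A\<close> on \<open>U\<close> and the values of the rule bodies. As t-norms lie below the minimum,
  the result is a prefixpoint strictly below \<open>A\<close>, a contradiction.\<close>

subsection \<open>T-norms\<close>

lemma tnorm_closed: "tnorm T \<Longrightarrow> x \<in> {0..1} \<Longrightarrow> y \<in> {0..1} \<Longrightarrow> T x y \<in> {0..1}"
  unfolding tnorm_def by blast

lemma tnorm_mono:
  "tnorm T \<Longrightarrow> x \<in> {0..1} \<Longrightarrow> x' \<in> {0..1} \<Longrightarrow> y \<in> {0..1} \<Longrightarrow> y' \<in> {0..1} \<Longrightarrow>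
    x \<le> x' \<Longrightarrow> y \<le> y' \<Longrightarrow> T x y \<le> T x' y'"
  unfolding tnorm_def by blast

lemma tnorm_one_left: "tnorm T \<Longrightarrow> x \<in> {0..1} \<Longrightarrow> T 1 x = x"
  unfolding tnorm_def by blast

lemma tnorm_one_right:
  assumes "tnorm T" "x \<in> {0..1}"
  shows "T x 1 = x"
proof -
  have "(1::real) \<in> {0..1}" by simp
  then have "T x 1 = T 1 x"
    using assms unfolding tnorm_def by blast
  then show ?thesis using assms by (simp add: tnorm_one_left)
qed

lemma tnorm_le_left: "tnorm T \<Longrightarrow> x \<in> {0..1} \<Longrightarrow> y \<in> {0..1} \<Longrightarrow> T x y \<le> x"
  using tnorm_mono[of T x x y 1] by (simp add: tnorm_one_right)

lemma tnorm_le_right: "tnorm T \<Longrightarrow> x \<in> {0..1} \<Longrightarrow> y \<in> {0..1} \<Longrightarrow> T x y \<le> y"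
  using tnorm_mono[of T x 1 y y] by (simp add: tnorm_one_left)

lemma tnorm_list_closed:
  "tnorm T \<Longrightarrow> set xs \<subseteq> {0..1} \<Longrightarrow> tnorm_list T xs \<in> {0..1}"
proof (induction T xs rule: tnorm_list.induct)
  case (3 T x y zs)
  then show ?case using tnorm_closed[of T x "tnorm_list T (y # zs)"] by simp
qed auto

text \<open>Monotonicity and the unit give \<open>T x y \<le> T x 1 = x\<close>, and likewise for
  \<open>y\<close>, so iterated t-norms stay below every argument.\<close>

lemma tnorm_list_le:
  "tnorm T \<Longrightarrow> set xs \<subseteq> {0..1} \<Longrightarrow> z \<in> set xs \<Longrightarrow> tnorm_list T xs \<le> z"
proof (induction T xs rule: tnorm_list.induct)
  case (3 T x y zs)
  let ?t = "tnorm_list T (y # zs)"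
  have x: "x \<in> {0..1}" and t: "?t \<in> {0..1}"
    using 3 tnorm_list_closed[of T "y # zs"] by auto
  show ?case
  proof (cases "z = x")
    case True
    then show ?thesis using tnorm_le_left[OF \<open>tnorm T\<close> x t] by simp
  next
    case False
    then have "?t \<le> z" using 3 by simp
    then show ?thesis using tnorm_le_right[OF \<open>tnorm T\<close> x t] by simp
  qed
qed auto

lemma tnorm_list_map_mono:
  assumes "tnorm T"
    and "\<And>b. b \<in> set bs \<Longrightarrow> f b \<in> {0..1}" "\<And>b. b \<in> set bs \<Longrightarrow> g b \<in> {0..1}"
    and "\<And>b. b \<in> set bs \<Longrightarrow> f b \<le> g b"
  shows "tnorm_list T (map f bs) \<le> tnorm_list T (map g bs)"
  using assms(2-)
proof (induction bs rule: induct_list012)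
  case (3 b c bs)
  have "tnorm_list T (map h (c # bs)) \<in> {0..1}"
    if "\<And>d. d \<in> set (c # bs) \<Longrightarrow> h d \<in> {0..1}" for h
    using that by (intro tnorm_list_closed assms(1)) auto
  then have closed: "tnorm_list T (map f (c # bs)) \<in> {0..1}" "tnorm_list T (map g (c # bs)) \<in> {0..1}"
    using 3 by simp_all
  have "tnorm_list T (map f (c # bs)) \<le> tnorm_list T (map g (c # bs))"
    by (rule "3.IH"(2)) (use 3 in auto)
  moreover have "f b \<in> {0..1}" "g b \<in> {0..1}" "f b \<le> g b"
    using 3 by (meson list.set_intros)+
  ultimately show ?case
    using tnorm_mono[OF assms(1), of "f b" "g b"] closed by simp
qed auto

text \<open>Left-continuity serves the forward direction: if \<open>T x 1 = x\<close> exceeds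
  \<open>y\<close>, so does \<open>T x l\<close> for all \<open>l\<close> close to 1, which keeps
  the supremum away from 1.\<close>

lemma residual_implicator_eq_1_iff:
  assumes T: "left_continuous_tnorm T" and x: "x \<in> {0..1}" and y: "y \<in> {0..1}"
  shows "residual_implicator T x y = 1 \<longleftrightarrow> x \<le> y"
proof
  have tn: "tnorm T" using T by (simp add: left_continuous_tnorm_def)
  let ?S = "{l \<in> {0..1}. T x l \<le> y}"
  show "residual_implicator T x y = 1" if "x \<le> y"
    unfolding residual_implicator_def
    by (rule cSup_eq_maximum) (use that tnorm_one_right[OF tn x] in auto)
  show "x \<le> y" if "residual_implicator T x y = 1"
  proof (rule ccontr)
    assume "\<not> x \<le> y"
    have "(T x \<longlongrightarrow> T x 1) (at_left 1)"
      using T x by (auto simp: left_continuous_tnorm_def continuous_within)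
    then have "\<forall>\<^sub>F l in at_left 1. y < T x l"
      using \<open>\<not> x \<le> y\<close> by (intro order_tendstoD) (auto simp: tnorm_one_right[OF tn x])
    then have "\<forall>\<^sub>F l in at_left 1. y < T x l \<and> l \<in> {0<..<1}"
      using eventually_at_left_real[of 0 1] by (simp add: eventually_conj_iff)
    then obtain k where k: "y < T x k" "0 < k" "k < 1"
      using eventually_happens'[OF trivial_limit_at_left_real] by fastforce
    have "l \<le> k" if "l \<in> ?S" for l
    proof (rule ccontr)
      assume "\<not> l \<le> k"
      then have "T x k \<le> T x l" using that k x by (intro tnorm_mono[OF tn]) auto
      then show False using that k by auto
    qed
    \<comment> \<open>The set must be nonempty for its supremum to be bounded by
      \<open>k\<close>.\<close>
    moreover have "T x 0 \<le> 0" using tnorm_le_right[OF tn x, of 0] by simp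
    then have "0 \<in> ?S" using y by simp
    ultimately have "Sup ?S \<le> k" by (intro cSup_least) blast+
    then show False using \<open>residual_implicator T x y = 1\<close> k by (simp add: residual_implicator_def)
  qed
qed

subsection \<open>Interpretations and least fixpoints\<close>

lemma interps_closed: "I \<in> interps B \<Longrightarrow> a \<in> B \<Longrightarrow> I a \<in> {0..1}"
  unfolding interps_def by blast

text \<open>Outside \<open>B\<close> both maps equal \<open>undefined\<close>, so the order of the
  function type is decided on \<open>B\<close>.\<close>

lemma interps_leI:
  assumes "I \<in> interps B" "J \<in> interps B" "\<And>a. a \<in> B \<Longrightarrow> I a \<le> J a"
  shows "I \<le> J"
proof (rule le_funI)
  fix a
  show "I a \<le> J a"
  proof (cases "a \<in> B")
    case False
    then have "I a = undefined" "J a = undefined"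
      using assms(1,2) PiE_arb unfolding interps_def by metis+
    then show ?thesis by simp
  qed (rule assms(3))
qed

lemma least_fixpoint_eqI:
  assumes "I \<in> interps B" "F I = I" "\<And>J. J \<in> interps B \<Longrightarrow> F J = J \<Longrightarrow> I \<le> J"
  shows "least_fixpoint B F = I"
  unfolding least_fixpoint_def by (rule Least_equality) (use assms in blast)+

text \<open>Knaster-Tarski. It cannot be quoted from the library, since \<open>interps B\<close> is a complete lattice
  only as a subset of a type without least or greatest element.\<close>

lemma
  assumes closed: "\<And>I. I \<in> interps B \<Longrightarrow> F I \<in> interps B"
    and mono: "\<And>I J. I \<in> interps B \<Longrightarrow> J \<in> interps B \<Longrightarrow> I \<le> J \<Longrightarrow> F I \<le> F J"
  shows least_fixpoint_fixed: "F (least_fixpoint B F) = least_fixpoint B F"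
    and least_fixpoint_le: "\<And>J. J \<in> interps B \<Longrightarrow> F J \<le> J \<Longrightarrow> least_fixpoint B F \<le> J"
proof -
  define S where "S = {J \<in> interps B. F J \<le> J}"
  define L where "L = (\<lambda>a\<in>B. INF J\<in>S. J a)"
  let ?one = "\<lambda>a\<in>B. 1 :: real"
  have one: "?one \<in> interps B" by (auto simp: interps_def)
  \<comment> \<open>The top element is a prefixpoint, so the infimum defining \<open>L\<close>
    ranges over a nonempty set.\<close>
  have "F ?one \<le> ?one"
    by (rule interps_leI[OF closed[OF one] one]) (use interps_closed[OF closed[OF one]] in auto)
  then have ne: "S \<noteq> {}" using one by (auto simp: S_def)
  have bdd: "bdd_below ((\<lambda>J. J a) ` S)" if "a \<in> B" for a
    using interps_closed[OF _ that] by (intro bdd_belowI[of _ 0]) (auto simp: S_def)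
  have lower: "L a \<le> J a" if "J \<in> S" "a \<in> B" for J a
    using cINF_lower[OF bdd[OF that(2)] that(1)] that(2) by (simp add: L_def)
  have greatest: "x \<le> L a" if "\<And>J. J \<in> S \<Longrightarrow> x \<le> J a" "a \<in> B" for x a
    using cINF_greatest[OF ne, of x "\<lambda>J. J a"] that by (simp add: L_def)
  have "L a \<in> {0..1}" if "a \<in> B" for a
  proof -
    have "0 \<le> J a" if "J \<in> S" for J
      using that interps_closed[of J B a] \<open>a \<in> B\<close> by (simp add: S_def)
    then have "0 \<le> L a" using that by (rule greatest)
    moreover have "L a \<le> 1"
      using lower[OF _ that, of ?one] one \<open>F ?one \<le> ?one\<close> that by (simp add: S_def)
    ultimately show ?thesis by simp
  qed
  then have L: "L \<in> interps B" by (auto simp: interps_def L_def)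
  have L_le: "L \<le> J" if "J \<in> S" for J
  proof (rule interps_leI[OF L])
    show "J \<in> interps B" using that by (simp add: S_def)
    show "L a \<le> J a" if "a \<in> B" for a using \<open>J \<in> S\<close> that by (rule lower)
  qed
  have FL_le: "F L \<le> L"
  proof (rule interps_leI[OF closed[OF L] L], rule greatest)
    fix a J assume "J \<in> S"
    then have "F L \<le> F J" "F J \<le> J" using mono[OF L _ L_le] by (simp_all add: S_def)
    then have "F L \<le> J" by (rule order_trans)
    then show "F L a \<le> J a" by (rule le_funD)
  qed
  \<comment> \<open>Monotonicity makes \<open>F L\<close> a prefixpoint too, hence an upper bound of
    \<open>L\<close>.\<close>
  moreover have "F L \<in> S"
    using closed[OF L] mono[OF closed[OF L] L FL_le] by (simp add: S_def)
  then have "L \<le> F L" by (rule L_le)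
  ultimately have fixed: "F L = L" by (rule antisym)
  have least: "least_fixpoint B F = L"
    by (rule least_fixpoint_eqI[of L B F, OF L fixed]) (rule L_le, simp add: S_def)
  show "F (least_fixpoint B F) = least_fixpoint B F" unfolding least by (rule fixed)
  show "least_fixpoint B F \<le> J" if "J \<in> interps B" "F J \<le> J" for J
    unfolding least by (rule L_le) (use that in \<open>simp add: S_def\<close>)
qed

subsection \<open>The immediate consequence operator\<close>

lemma finite_rules_for: "finite P \<Longrightarrow> finite (rules_for P a)"
  by (simp add: rules_for_def)

lemma body_val_le_imm_cons:
  assumes "finite P" "a \<in> B" "r \<in> rules_for P a"
  shows "body_val I r \<le> imm_cons B P I a"
proof -
  have "body_val I r \<le> (SUP r\<in>rules_for P a. body_val I r)"
    by (rule cSUP_upper[OF assms(3)]) (simp add: assms(1) finite_rules_for)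
  moreover have "rules_for P a \<noteq> {}" using assms(3) by blast
  ultimately show ?thesis using assms(2) by (simp add: imm_cons_def)
qed

text \<open>The condition \<open>0 \<le> c\<close> covers atoms without rules, where the operator
  takes the default value 0.\<close>

lemma imm_cons_le_iff:
  assumes "finite P" "a \<in> B" "0 \<le> c"
  shows "imm_cons B P I a \<le> c \<longleftrightarrow> (\<forall>r\<in>rules_for P a. body_val I r \<le> c)"
proof (cases "rules_for P a = {}")
  case True
  then show ?thesis using assms by (simp add: imm_cons_def)
next
  case False
  have "(SUP r\<in>rules_for P a. body_val I r) \<le> c \<longleftrightarrow> (\<forall>r\<in>rules_for P a. body_val I r \<le> c)"
    by (rule cSUP_le_iff[OF False]) (simp add: assms(1) finite_rules_for)
  then show ?thesis using assms(2) False by (simp add: imm_cons_def)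
qed

lemma imm_cons_in_interps:
  assumes "finite P" "\<And>r. r \<in> P \<Longrightarrow> body_val I r \<in> {0..1}"
  shows "imm_cons B P I \<in> interps B"
proof -
  have "imm_cons B P I a \<in> {0..1}" if "a \<in> B" for a
  proof (cases "rules_for P a = {}")
    case True
    then show ?thesis using that by (simp add: imm_cons_def)
  next
    case False
    then obtain r where r: "r \<in> rules_for P a" by blast
    then have "0 \<le> body_val I r" using assms(2) by (auto simp: rules_for_def)
    then have "0 \<le> imm_cons B P I a"
      using body_val_le_imm_cons[OF assms(1) that r] by (rule order_trans)
    then show ?thesis
      using assms that by (auto simp: imm_cons_le_iff rules_for_def)
  qed
  then show ?thesis by (auto simp: interps_def imm_cons_def)
qed

lemma rules_for_reduct:
  fixes P :: "'a rule set"
  shows "rules_for (reduct P A) a = reduct_rule A ` rules_for P a"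
proof -
  have "head (reduct_rule A r) = head r" for r :: "'a rule"
    by (simp add: reduct_rule_def)
  then show ?thesis by (auto simp: rules_for_def reduct_def)
qed

subsection \<open>Bodies of reduced rules\<close>

lemma body_val_reduct_rule:
  "body_val I (reduct_rule A r) =
    tnorm_list (rule_tnorm r) (map (\<lambda>b. ext_val I (reduct_ext A b)) (body r))"
  by (simp add: body_val_def reduct_rule_def comp_def)

text \<open>The constants frozen into the reduct are the values of the negative literals at
  \<open>A\<close> itself. This carries statements about \<open>P\<close> at \<open>A\<close> over
  to the operator of the reduct.\<close>

lemma body_val_reduct_rule_self: "body_val A (reduct_rule A r) = body_val A r"
proof -
  have "ext_val A (reduct_ext A b) = ext_val A b" for b
    by (cases b) auto
  then show ?thesis by (simp add: body_val_reduct_rule) (simp add: body_val_def)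
qed

lemma pos_lits_atom_in: "Atom a \<in> pos_lits r \<Longrightarrow> a \<in> atoms_rule r"
  by (cases r) (force simp: pos_lits_def)

lemma wf_rule_tnorm: "wf_rule r \<Longrightarrow> tnorm (rule_tnorm r)"
  by (simp add: wf_rule_def left_continuous_tnorm_def)

lemma ext_val_reduct_closed:
  assumes "wf_rule r" "atoms_rule r \<subseteq> B" "A \<in> interps B" "I \<in> interps B" "b \<in> set (body r)"
  shows "ext_val I (reduct_ext A b) \<in> {0..1}"
proof (cases b)
  case (Pos l)
  show ?thesis
  proof (cases l)
    case (Atom a)
    then have "a \<in> B" using Pos assms pos_lits_atom_in[of a r] by (auto simp: pos_lits_def)
    then show ?thesis using Pos Atom interps_closed[OF assms(4)] by simp
  next
    case (Const c)
    then show ?thesis using Pos assms by (auto simp: wf_rule_def)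
  qed
next
  case (Neg N a)
  have "a \<in> atoms_rule r"
    using assms(5) Neg by (cases r) force
  then have "A a \<in> {0..1}" using assms(2) by (intro interps_closed[OF assms(3)]) auto
  moreover have "negator N" using assms Neg by (auto simp: wf_rule_def)
  ultimately have "N (A a) \<in> {0..1}" unfolding negator_def by blast
  then show ?thesis using Neg by simp
qed

lemma body_val_reduct_closed:
  assumes "wf_rule r" "atoms_rule r \<subseteq> B" "A \<in> interps B" "I \<in> interps B"
  shows "body_val I (reduct_rule A r) \<in> {0..1}"
  unfolding body_val_reduct_rule
  by (rule tnorm_list_closed[OF wf_rule_tnorm[OF assms(1)]])
    (use ext_val_reduct_closed[OF assms] in auto)

lemma body_val_closed:
  assumes "wf_rule r" "atoms_rule r \<subseteq> B" "I \<in> interps B"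
  shows "body_val I r \<in> {0..1}"
  using body_val_reduct_closed[OF assms(1,2,3,3)] by (simp add: body_val_reduct_rule_self)

text \<open>Negative literals have become constants, so a reduced body depends on the interpretation
  only through its positive atoms. Comparing just these matters when \<open>A \<le> J\<close> is
  known only off an unfounded set.\<close>

lemma body_val_reduct_mono:
  assumes "wf_rule r" "atoms_rule r \<subseteq> B" "A \<in> interps B" "I \<in> interps B" "J \<in> interps B"
    and le: "\<And>a. Atom a \<in> pos_lits r \<Longrightarrow> I a \<le> J a"
  shows "body_val I (reduct_rule A r) \<le> body_val J (reduct_rule A r)"
  unfolding body_val_reduct_rule
proof (rule tnorm_list_map_mono[OF wf_rule_tnorm[OF assms(1)]])
  fix b assume b: "b \<in> set (body r)"
  show "ext_val I (reduct_ext A b) \<in> {0..1}" "ext_val J (reduct_ext A b) \<in> {0..1}"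
    using ext_val_reduct_closed b assms by blast+
  show "ext_val I (reduct_ext A b) \<le> ext_val J (reduct_ext A b)"
  proof (cases b)
    case (Pos l)
    then show ?thesis using b le by (cases l) (auto simp: pos_lits_def)
  qed simp
qed

lemma body_val_reduct_le:
  assumes "wf_rule r" "atoms_rule r \<subseteq> B" "A \<in> interps B" "I \<in> interps B" "Atom a \<in> pos_lits r"
  shows "body_val I (reduct_rule A r) \<le> I a"
  unfolding body_val_reduct_rule
proof (rule tnorm_list_le[OF wf_rule_tnorm[OF assms(1)]])
  show "set (map (\<lambda>b. ext_val I (reduct_ext A b)) (body r)) \<subseteq> {0..1}"
    using ext_val_reduct_closed[OF assms(1-4)] by auto
  show "I a \<in> set (map (\<lambda>b. ext_val I (reduct_ext A b)) (body r))"
    using assms(5) by (force simp: pos_lits_def)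
qed

text \<open>Residuation: implicators disappear from the argument here, and being a model becomes a
  family of inequalities.\<close>

lemma rule_val_eq_1_iff:
  assumes "wf_rule r" "atoms_rule r \<subseteq> B" "I \<in> interps B"
  shows "rule_val I r = 1 \<longleftrightarrow> body_val I r \<le> lit_val I (head r)"
proof -
  have "lit_val I (head r) \<in> {0..1}"
  proof (cases "head r")
    case (Atom a)
    then have "a \<in> B" using assms(2) by (cases r) auto
    then show ?thesis using Atom assms interps_closed by fastforce
  next
    case (Const c)
    then show ?thesis using assms by (auto simp: wf_rule_def)
  qed
  then show ?thesis
    using assms body_val_closed[OF assms] unfolding rule_val_def
    by (intro residual_implicator_eq_1_iff) (auto simp: wf_rule_def)
qed

subsection \<open>Answer sets\<close>

locale fasp =
  fixes P :: "'a rule set" and A :: "'a \<Rightarrow> real"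
  assumes prog: "fasp_program P" and interp: "A \<in> interps (atoms P)"
begin

text \<open>The reduct stays frozen at \<open>A\<close> while the argument varies; this makes the
  operator monotone.\<close>

abbreviation cons :: "('a \<Rightarrow> real) \<Rightarrow> 'a \<Rightarrow> real" where
  "cons \<equiv> imm_cons (atoms P) (reduct P A)"

lemma finite_program: "finite P"
  using prog by (simp add: fasp_program_def)

lemma finite_reduct: "finite (reduct P A)"
  using finite_program by (simp add: reduct_def)

lemma wf: "r \<in> P \<Longrightarrow> wf_rule r"
  using prog by (simp add: fasp_program_def)

lemma atoms_rule_subset: "r \<in> P \<Longrightarrow> atoms_rule r \<subseteq> atoms P"
  by (auto simp: atoms_def)

lemmas rule_facts = wf atoms_rule_subset

lemma cons_le_iff:
  "a \<in> atoms P \<Longrightarrow> 0 \<le> c \<Longrightarrow>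
    cons I a \<le> c \<longleftrightarrow> (\<forall>r\<in>rules_for P a. body_val I (reduct_rule A r) \<le> c)"
  using finite_reduct by (simp add: imm_cons_le_iff rules_for_reduct)

lemma cons_in_interps: "I \<in> interps (atoms P) \<Longrightarrow> cons I \<in> interps (atoms P)"
  using body_val_reduct_closed[OF rule_facts interp]
  by (intro imm_cons_in_interps[OF finite_reduct]) (auto simp only: reduct_def)

text \<open>With \<open>J = I\<close> this describes prefixpoints rule by rule; a separate
  \<open>J\<close> also allows \<open>cons J\<close> as the bound, as monotonicity requires.\<close>

lemma cons_le_interp_iff:
  assumes "I \<in> interps (atoms P)" "J \<in> interps (atoms P)"
  shows "cons I \<le> J \<longleftrightarrow>
    (\<forall>a\<in>atoms P. \<forall>r\<in>rules_for P a. body_val I (reduct_rule A r) \<le> J a)"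
    (is "_ \<longleftrightarrow> ?R")
proof -
  have pointwise: "cons I a \<le> J a \<longleftrightarrow> (\<forall>r\<in>rules_for P a. body_val I (reduct_rule A r) \<le> J a)"
    if "a \<in> atoms P" for a
    using cons_le_iff[OF that, of "J a" I] interps_closed[OF assms(2) that] by simp
  have "?R \<Longrightarrow> cons I \<le> J"
    using pointwise by (intro interps_leI[OF cons_in_interps[OF assms(1)] assms(2)]) simp
  moreover have "cons I \<le> J \<Longrightarrow> ?R"
    using pointwise by (simp add: le_fun_def)
  ultimately show ?thesis by blast
qed

lemma cons_mono:
  assumes "I \<in> interps (atoms P)" "J \<in> interps (atoms P)" "I \<le> J"
  shows "cons I \<le> cons J"
proof -
  have "body_val I (reduct_rule A r) \<le> cons J a" if "a \<in> atoms P" "r \<in> rules_for P a" for a r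
  proof -
    have "r \<in> P" using that by (simp add: rules_for_def)
    then have "body_val I (reduct_rule A r) \<le> body_val J (reduct_rule A r)"
      using body_val_reduct_mono[OF rule_facts interp assms(1,2)] assms(3)
      by (simp add: le_fun_def)
    also have "\<dots> \<le> cons J a"
      using that finite_reduct by (intro body_val_le_imm_cons) (auto simp: rules_for_reduct)
    finally show ?thesis .
  qed
  then show ?thesis
    using assms by (simp add: cons_le_interp_iff cons_in_interps)
qed

text \<open>By residuation, a rule with an atom as head is satisfied iff its body value is at most
  the value of its head. At \<open>A\<close> the reduct does not change body values, so these rules
  together say that \<open>A\<close> is a prefixpoint.\<close>

lemma model_iff:
  "model P A \<longleftrightarrow> cons A \<le> A \<and> (\<forall>r\<in>constraints P. rule_val A r = 1)"
proof -
  have rule_val: "rule_val A r = 1 \<longleftrightarrow> body_val A r \<le> lit_val A (head r)" if "r \<in> P" for r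
    using rule_val_eq_1_iff[OF rule_facts[OF that] interp] .
  have "(\<exists>a. head r = Atom a) \<or> (\<exists>c. head r = Const c)" for r :: "'a rule"
    by (cases "head r") auto
  then have split: "model P A \<longleftrightarrow> (\<forall>a. \<forall>r\<in>rules_for P a. rule_val A r = 1) \<and>
      (\<forall>r\<in>constraints P. rule_val A r = 1)"
    unfolding model_def constraints_def rules_for_def by blast
  have "(\<forall>a. \<forall>r\<in>rules_for P a. rule_val A r = 1) \<longleftrightarrow>
    (\<forall>a. \<forall>r\<in>rules_for P a. body_val A r \<le> A a)"
    by (simp add: rules_for_def rule_val)
  also have "\<dots> \<longleftrightarrow> (\<forall>a\<in>atoms P. \<forall>r\<in>rules_for P a. body_val A r \<le> A a)"
  proof -
    have "a \<in> atoms P" if "r \<in> rules_for P a" for a r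
      using that atoms_rule_subset[of r] by (cases r) (auto simp: rules_for_def)
    then show ?thesis by blast
  qed
  also have "\<dots> \<longleftrightarrow> cons A \<le> A"
    using interp by (simp add: cons_le_interp_iff body_val_reduct_rule_self)
  finally show ?thesis unfolding split by simp
qed

text \<open>If \<open>A\<close> exceeded \<open>cons A\<close> at \<open>a\<close>, all bodies of
  rules for \<open>a\<close> would have values strictly below \<open>A a\<close>, and the singleton
  of \<open>a\<close> would be unfounded inside the support.\<close>

lemma answer_set_fixpoint:
  assumes "answer_set P A"
  shows "cons A = A"
proof (rule antisym)
  show le: "cons A \<le> A" using assms by (simp add: answer_set_def model_iff)
  show "A \<le> cons A"
  proof (rule interps_leI[OF interp cons_in_interps[OF interp]], rule ccontr)
    fix a assume a: "a \<in> atoms P" and "\<not> A a \<le> cons A a"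
    then have less: "cons A a < A a" by simp
    have nonneg: "0 \<le> cons A a" using interps_closed[OF cons_in_interps[OF interp] a] by simp
    have "\<forall>r\<in>rules_for P a. body_val A r \<le> cons A a"
      using cons_le_iff[OF a nonneg, of A] by (simp add: body_val_reduct_rule_self)
    then have "unfounded P A {a}"
      using a less by (auto simp: unfounded_def)
    moreover have "a \<in> supp P A" using a less nonneg by (simp add: supp_def)
    ultimately show False
      using assms by (auto simp: answer_set_def unfounded_free_def)
  qed
qed

lemma answer_set_le_fixpoint:
  assumes "answer_set P A" and J: "J \<in> interps (atoms P)" and "cons J \<le> J"
  shows "A \<le> J"
proof -
  let ?U = "{a \<in> atoms P. J a < A a}"
  have "unfounded P A ?U"
    unfolding unfounded_def
  proof (intro conjI ballI)
    fix u r assume u: "u \<in> ?U" and r: "r \<in> rules_for P u"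
    then have "r \<in> P" by (simp add: rules_for_def)
    show "Atom ` ?U \<inter> pos_lits r \<noteq> {} \<or> body_val A r < A u \<or> body_val A r = 0"
    proof (cases "Atom ` ?U \<inter> pos_lits r = {}")
      case True
      \<comment> \<open>The body avoids \<open>?U\<close>, so \<open>A\<close> is below
        \<open>J\<close> on all its positive atoms, and the body value at \<open>A\<close> is
        bounded by that at \<open>J\<close>, hence by \<open>J u < A u\<close>.\<close>
      have "A a \<le> J a" if "Atom a \<in> pos_lits r" for a
      proof (rule ccontr)
        assume "\<not> A a \<le> J a"
        moreover have "a \<in> atoms P"
          using pos_lits_atom_in[OF that] atoms_rule_subset[OF \<open>r \<in> P\<close>] by blast
        ultimately have "Atom a \<in> Atom ` ?U" by simp
        then show False using True that by blast
      qed
      then have "body_val A (reduct_rule A r) \<le> body_val J (reduct_rule A r)"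
        using body_val_reduct_mono[OF rule_facts interp interp J] \<open>r \<in> P\<close> by blast
      also have "\<dots> \<le> J u" using assms(3) u r by (simp add: cons_le_interp_iff[OF J J])
      also have "\<dots> < A u" using u by simp
      finally show ?thesis by (simp add: body_val_reduct_rule_self)
    qed simp
  qed auto
  moreover have "?U \<subseteq> supp P A"
    using interps_closed[OF J] by (force simp: supp_def)
  ultimately have "?U = {}"
    using assms(1) by (auto simp: answer_set_def unfounded_free_def)
  then show "A \<le> J" using interp J by (intro interps_leI[of _ "atoms P"]) (auto simp: not_less)
qed

text \<open>Minimality is assumed among prefixpoints, because the lowered map \<open>J\<close> is
  only shown to be a prefixpoint.\<close>

lemma least_fixpoint_unfounded_free:
  assumes fixed: "cons A = A"
    and least: "\<And>J. J \<in> interps (atoms P) \<Longrightarrow> cons J \<le> J \<Longrightarrow> A \<le> J"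
  shows "unfounded_free P A"
  unfolding unfounded_free_def
proof (intro allI impI, rule ccontr)
  fix U assume unf: "unfounded P A U" and "supp P A \<inter> U \<noteq> {}"
  then obtain v where v: "v \<in> U" "0 < A v" by (auto simp: supp_def)
  have U: "U \<subseteq> atoms P" using unf by (simp add: unfounded_def)
  have "finite (atoms P)"
  proof -
    have "finite (atoms_rule r)" for r :: "'a rule"
    proof (cases r)
      case (Rule h T bs)
      have "finite (set_literal l)" for l :: "'a literal" by (cases l) auto
      moreover from this have "finite (set_ext_literal b)" for b :: "'a ext_literal"
        by (cases b) auto
      ultimately show ?thesis using Rule by simp
    qed
    then show ?thesis using finite_program by (simp add: atoms_def)
  qed
  then have finU: "finite U" using U finite_subset by blast
  define m where "m = Max (A ` U)"
  have A_le_m: "A u \<le> m" if "u \<in> U" for u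
    using that finU by (simp add: m_def)
  then have m_pos: "0 < m" using v by (meson less_le_trans)
  \<comment> \<open>The candidates match the three ways for a rule to meet the unfoundedness
    condition: values of \<open>A\<close> on \<open>U\<close> for a positive literal in
    \<open>U\<close>, body values for a body strictly below the head, and 0 for a vanishing body.
    Finiteness leaves a gap between \<open>k\<close> and \<open>m\<close>.\<close>
  define V where "V = {x \<in> insert 0 (A ` U \<union> body_val A ` P). x < m}"
  define k where "k = Max V"
  have finV: "finite V" using finU finite_program by (simp add: V_def)
  have V_le_k: "x \<le> k" if "x \<in> V" for x using finV that by (simp add: k_def)
  have "0 \<in> V" using m_pos by (simp add: V_def)
  then have k_nonneg: "0 \<le> k" by (rule V_le_k)
  have "k \<in> V" unfolding k_def using finV \<open>0 \<in> V\<close> by (intro Max_in) auto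
  then have "k < m" by (simp add: V_def)
  obtain w where w: "w \<in> U" "A w = m"
    using Max_in[of "A ` U"] finU v unfolding m_def
    by (metis empty_iff finite_imageI image_iff image_is_empty)
  have "m \<le> 1" using w U interps_closed[OF interp, of w] by auto
  \<comment> \<open>Only maximal points of \<open>U\<close> are lowered; outside
    \<open>atoms P\<close> the value \<open>undefined\<close> survives, so \<open>J\<close> remains
    extensional.\<close>
  define J where "J = (\<lambda>a. if a \<in> U \<and> A a = m then k else A a)"
  have J: "J \<in> interps (atoms P)"
    using interp U k_nonneg \<open>k < m\<close> \<open>m \<le> 1\<close>
    by (auto simp: J_def interps_def PiE_iff extensional_def)
  have J_le: "J a \<le> A a" for a using \<open>k < m\<close> by (simp add: J_def)
  have "body_val J (reduct_rule A r) \<le> J a" if "a \<in> atoms P" and r: "r \<in> rules_for P a" for a r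
  proof -
    have "r \<in> P" using r by (simp add: rules_for_def)
    note rf = rule_facts[OF this] interp
    have body_le: "body_val J (reduct_rule A r) \<le> body_val A r"
      using body_val_reduct_mono[OF rf J interp J_le] by (simp add: body_val_reduct_rule_self)
    show ?thesis
    proof (cases "a \<in> U \<and> A a = m")
      case False
      have "body_val A r \<le> A a"
        using fixed that cons_le_interp_iff[OF interp interp]
        by (simp add: body_val_reduct_rule_self)
      moreover have "J a = A a" using False unfolding J_def by (rule if_not_P)
      ultimately show ?thesis using body_le by simp
    next
      case True
      then have "Atom ` U \<inter> pos_lits r \<noteq> {} \<or> body_val A r < m \<or> body_val A r = 0"
        using unf r unfolding unfounded_def by blast
      then consider (lit) u where "u \<in> U" "Atom u \<in> pos_lits r"
        | (less) "body_val A r < m" | (zero) "body_val A r = 0"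
        by blast
      then have "body_val J (reduct_rule A r) \<le> k"
      proof cases
        case lit
        \<comment> \<open>On all of \<open>U\<close> the map \<open>J\<close> is at most
          \<open>k\<close>: a value \<open>m\<close> was lowered to \<open>k\<close>, and any
          smaller value of \<open>A\<close> lies in \<open>V\<close>. The t-norm passes this bound
          on to the body.\<close>
        have "J u \<le> k"
        proof (cases "A u = m")
          case False
          then have "A u \<in> V" using lit A_le_m[of u] by (simp add: V_def)
          then show ?thesis using False V_le_k by (simp add: J_def)
        qed (use lit in \<open>simp add: J_def\<close>)
        then show ?thesis
          using body_val_reduct_le[OF rf J lit(2)] by linarith
      next
        case less
        then have "body_val A r \<in> V" using \<open>r \<in> P\<close> by (simp add: V_def)
        then show ?thesis using V_le_k body_le by (meson order_trans)
      next
        case zero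
        then show ?thesis using k_nonneg body_le by simp
      qed
      then show ?thesis using True by (simp add: J_def)
    qed
  qed
  then have "cons J \<le> J" by (simp add: cons_le_interp_iff[OF J J])
  \<comment> \<open>At \<open>w\<close> the maximum \<open>m\<close> was attained, so minimality
    would force \<open>m \<le> k\<close>.\<close>
  then have "A w \<le> J w" using least[OF J] by (simp add: le_fun_def)
  then show False using w \<open>k < m\<close> by (simp add: J_def)
qed

lemma answer_set_iff_least_fixpoint:
  "answer_set P A \<longleftrightarrow>
    A = least_fixpoint (atoms P) cons \<and> (\<forall>r\<in>constraints P. rule_val A r = 1)"
proof (intro iffI conjI)
  assume ans: "answer_set P A"
  show "A = least_fixpoint (atoms P) cons"
    using answer_set_fixpoint[OF ans] answer_set_le_fixpoint[OF ans] interp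
    by (intro least_fixpoint_eqI[symmetric]) auto
  show "\<forall>r\<in>constraints P. rule_val A r = 1"
    using ans by (simp add: answer_set_def model_iff)
next
  assume R: "A = least_fixpoint (atoms P) cons \<and> (\<forall>r\<in>constraints P. rule_val A r = 1)"
  then have lfp: "least_fixpoint (atoms P) cons = A" by simp
  have fixed: "cons A = A"
    using least_fixpoint_fixed[of "atoms P" cons, OF cons_in_interps cons_mono] unfolding lfp .
  \<comment> \<open>Knaster-Tarski yields minimality among all prefixpoints, as the lowering
    argument demands.\<close>
  have "A \<le> J" if "J \<in> interps (atoms P)" "cons J \<le> J" for J
    using least_fixpoint_le[of "atoms P" cons J, OF cons_in_interps cons_mono that] unfolding lfp .
  then have "unfounded_free P A" by (rule least_fixpoint_unfounded_free[OF fixed])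
  then show "answer_set P A"
    using interp fixed R by (simp add: answer_set_def model_iff)
qed

end

text \<open>The operator does not see constraints, so their satisfaction is a separate conjunct: a
  program whose only rule has head \<open>Const 0\<close> and body \<open>Const 1\<close> has a
  least fixpoint but no model. For programs without constraints the conjunct is vacuous.\<close>

theorem proposition1:
  fixes P :: "'a rule set" and A :: "'a \<Rightarrow> real"
  assumes "fasp_program P"
    and "A \<in> interps (atoms P)"
  shows "answer_set P A \<longleftrightarrow>
           A = least_fixpoint (atoms P) (imm_cons (atoms P) (reduct P A)) \<and>
           (\<forall>r\<in>constraints P. rule_val A r = 1)"
  using assms by (intro fasp.answer_set_iff_least_fixpoint fasp.intro)

end
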